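(* Let $\alpha,\beta,\gamma\in(0,1]$ and $0<\tau<1$. Put $$u(t,s)=\frac{(\alpha+\beta)t^{\alpha}s^{\beta}-\alpha t^{\alpha+\beta}}{\alpha\beta(\alpha+\beta)},\qquad x(t,s)=\frac{\alpha t^{\alpha}(t^{\beta}-s^{\beta})+\beta s^{\beta}(s^{\alpha}-t^{\alpha})}{\alpha\beta(\alpha+\beta)}.$$ The Green's function corresponding to the homogeneous problem $$D^{\gamma}D^{\beta}D^{\alpha}y(t)=0$$ with boundary conditions $$y(0)=D^{\alpha}y(\tau)=D^{\beta}D^{\alpha}y(1)=0$$ is, for $t,s\in[0,1]$, $$G(t,s)=\begin{cases} s\in[0,\tau]: & \begin{cases}u(t,s) & : t\le s,\\ x(0,s) & : s\le t,\end{cases}\\[2ex] s\in[\tau,1]: & \begin{cases}u(t,\tau) & : t\le s,\\ u(t,\tau)+x(t,s) & : s\le t.\end{cases}\end{cases}$$ That is, for every continuous function $h$ on $[0,1]$, the function $y(t)=\int_0^1G(t,s)h(s)s^{\gamma-1}\,ds$ is a solution of $D^{\gamma}D^{\beta}D^{\alpha}y(t)=h(t)$ on $[0,1]$ satisfying these boundary conditions.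
   Context: For $\alpha\in(0,1]$ the conformable fractional derivative of order $\alpha$ of a function $f$ is $D^{\alpha}f(t):=\lim_{\varepsilon\to0}\frac{f(te^{\varepsilon t^{-\alpha}})-f(t)}{\varepsilon}$ for $t>0$, and $D^{\alpha}f(0):=\lim_{t\to0^+}D^{\alpha}f(t)$; if $f$ is differentiable at $t>0$ then $D^{\alpha}f(t)=t^{1-\alpha}f'(t)$. For functions on $[0,1]$ the derivative at $t=1$ is one-sided. Iterated symbols such as $D^{\gamma}D^{\beta}D^{\alpha}y$ mean $D^{\gamma}(D^{\beta}(D^{\alpha}y))$. The two-variable function $x(\cdot,\cdot)$ is called the Cauchy function. The term "Green's function" is meant in the sense spelled out in the claim (kernel of the solution operator with respect to the weight $s^{\gamma-1}\,ds$). *)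

theory Defs
  imports "HOL-Analysis.Analysis"
begin

text \<open>
  Conformable derivative of order \<open>\<alpha>\<close> at \<open>t > 0\<close> of a function on \<open>[0,1]\<close>.  The increments
  \<open>\<epsilon>\<close> are restricted to those keeping the shifted argument in \<open>[0,1]\<close>: for \<open>0 < t < 1\<close> this
  is no restriction near \<open>\<epsilon> = 0\<close>, and for \<open>t = 1\<close> it yields the one-sided limit.
  Only values on \<open>[0,1]\<close> enter, so iterating the operator is unproblematic.
\<close>

definition conf_filter :: "real \<Rightarrow> real \<Rightarrow> real filter" where
  "conf_filter \<alpha> t = at 0 within {\<epsilon>. t * exp (\<epsilon> * t powr (-\<alpha>)) \<in> {0..1}}"

definition conf_quotient :: "real \<Rightarrow> (real \<Rightarrow> real) \<Rightarrow> real \<Rightarrow> real \<Rightarrow> real" where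
  "conf_quotient \<alpha> f t \<epsilon> = (f (t * exp (\<epsilon> * t powr (-\<alpha>))) - f t) / \<epsilon>"

definition conf_deriv :: "real \<Rightarrow> (real \<Rightarrow> real) \<Rightarrow> real \<Rightarrow> real" where
  "conf_deriv \<alpha> f t =
     (if t = 0 then Lim (at_right 0) (\<lambda>r. Lim (conf_filter \<alpha> r) (conf_quotient \<alpha> f r))
      else Lim (conf_filter \<alpha> t) (conf_quotient \<alpha> f t))"

text \<open>
  Since \<open>Lim\<close> is total, existence of the limits is recorded separately.
\<close>

definition conf_differentiable :: "real \<Rightarrow> (real \<Rightarrow> real) \<Rightarrow> real \<Rightarrow> bool" where
  "conf_differentiable \<alpha> f t \<longleftrightarrow>
     (if t = 0 then
        (\<forall>\<^sub>F r in at_right 0. \<exists>L. (conf_quotient \<alpha> f r \<longlongrightarrow> L) (conf_filter \<alpha> r)) \<and>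
        (\<exists>L. (conf_deriv \<alpha> f \<longlongrightarrow> L) (at_right 0))
      else \<exists>L. (conf_quotient \<alpha> f t \<longlongrightarrow> L) (conf_filter \<alpha> t))"

lemma conf_filter_nontrivial:
  assumes "0 < t" "t \<le> 1"
  shows "conf_filter \<alpha> t \<noteq> bot"
proof -
  have "{..0} \<subseteq> {\<epsilon>. t * exp (\<epsilon> * t powr (-\<alpha>)) \<in> {0..1}}"
  proof
    fix e :: real assume "e \<in> {..0}"
    then have "exp (e * t powr (-\<alpha>)) \<le> 1"
      by (simp add: mult_nonpos_nonneg)
    then have "t * exp (e * t powr (-\<alpha>)) \<le> 1 * 1"
      using assms by (intro mult_mono) auto
    then show "e \<in> {\<epsilon>. t * exp (\<epsilon> * t powr (-\<alpha>)) \<in> {0..1}}"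
      using assms by auto
  qed
  then have "at 0 within {..0} \<le> conf_filter \<alpha> t"
    unfolding conf_filter_def by (rule at_le)
  moreover have "at (0::real) within {..0} \<noteq> bot"
    using trivial_limit_at_left_real[of 0] at_le[of "{..<0::real}" "{..0}" 0]
    by (metis bot.extremum_uniqueI ivl_disj_un_singleton(2) sup_ge1)
  ultimately show ?thesis
    by (metis bot.extremum_uniqueI)
qed

lemma conf_deriv_eq:
  assumes f: "(f has_field_derivative D) (at t within {0..1})" and t: "0 < t" "t \<le> 1"
  shows "conf_differentiable \<alpha> f t" and "conf_deriv \<alpha> f t = t powr (1 - \<alpha>) * D"
proof -
  define S where "S = {\<epsilon>. t * exp (\<epsilon> * t powr (-\<alpha>)) \<in> {0..1::real}}"
  let ?p = "\<lambda>\<epsilon>. t * exp (\<epsilon> * t powr (-\<alpha>))"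
  have p: "(?p has_field_derivative t powr (1 - \<alpha>)) (at 0 within S)"
    using t by (auto intro!: derivative_eq_intros simp: powr_diff powr_minus field_simps)
  have "?p ` S \<subseteq> {0..1}" by (auto simp: S_def)
  then have "(f has_field_derivative D) (at (?p 0) within ?p ` S)"
    using f by (auto intro: DERIV_subset)
  from DERIV_image_chain[OF this p]
  have "((\<lambda>\<epsilon>. (f (?p \<epsilon>) - f t) / \<epsilon>) \<longlongrightarrow> D * t powr (1 - \<alpha>)) (at 0 within S)"
    by (simp add: has_field_derivative_iff o_def)
  then have lim: "(conf_quotient \<alpha> f t \<longlongrightarrow> t powr (1 - \<alpha>) * D) (conf_filter \<alpha> t)"
    by (simp add: conf_quotient_def[abs_def] conf_filter_def S_def mult.commute)
  show "conf_differentiable \<alpha> f t"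
    using t lim by (auto simp: conf_differentiable_def)
  show "conf_deriv \<alpha> f t = t powr (1 - \<alpha>) * D"
    using t tendsto_Lim[OF conf_filter_nontrivial lim] by (simp add: conf_deriv_def)
qed

definition u_fun :: "real \<Rightarrow> real \<Rightarrow> real \<Rightarrow> real \<Rightarrow> real" where
  "u_fun \<alpha> \<beta> t s =
     ((\<alpha> + \<beta>) * t powr \<alpha> * s powr \<beta> - \<alpha> * t powr (\<alpha> + \<beta>)) / (\<alpha> * \<beta> * (\<alpha> + \<beta>))"

definition cauchy_fun :: "real \<Rightarrow> real \<Rightarrow> real \<Rightarrow> real \<Rightarrow> real" where
  "cauchy_fun \<alpha> \<beta> t s =
     (\<alpha> * t powr \<alpha> * (t powr \<beta> - s powr \<beta>) + \<beta> * s powr \<beta> * (s powr \<alpha> - t powr \<alpha>))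
       / (\<alpha> * \<beta> * (\<alpha> + \<beta>))"

definition green_fun :: "real \<Rightarrow> real \<Rightarrow> real \<Rightarrow> real \<Rightarrow> real \<Rightarrow> real" where
  "green_fun \<alpha> \<beta> \<tau> t s =
     (if s \<le> \<tau> then (if t \<le> s then u_fun \<alpha> \<beta> t s else cauchy_fun \<alpha> \<beta> 0 s)
      else (if t \<le> s then u_fun \<alpha> \<beta> t \<tau> else u_fun \<alpha> \<beta> t \<tau> + cauchy_fun \<alpha> \<beta> t s))"

text \<open>
  The closed cases \<open>s \<in> [0,\<tau>]\<close>, \<open>s \<in> [\<tau>,1]\<close> and \<open>t \<le> s\<close>, \<open>s \<le> t\<close> overlap, but their
  formulas agree there, so the nested conditional satisfies all four of them.
\<close>

lemma green_fun_cases: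
  assumes "0 < \<alpha>" "0 < \<beta>"
  shows "s \<le> \<tau> \<Longrightarrow> t \<le> s \<Longrightarrow> green_fun \<alpha> \<beta> \<tau> t s = u_fun \<alpha> \<beta> t s"
    and "s \<le> \<tau> \<Longrightarrow> s \<le> t \<Longrightarrow> green_fun \<alpha> \<beta> \<tau> t s = cauchy_fun \<alpha> \<beta> 0 s"
    and "\<tau> \<le> s \<Longrightarrow> t \<le> s \<Longrightarrow> green_fun \<alpha> \<beta> \<tau> t s = u_fun \<alpha> \<beta> t \<tau>"
    and "\<tau> \<le> s \<Longrightarrow> s \<le> t \<Longrightarrow> green_fun \<alpha> \<beta> \<tau> t s = u_fun \<alpha> \<beta> t \<tau> + cauchy_fun \<alpha> \<beta> t s"
proof -
  have diag: "u_fun \<alpha> \<beta> s s = cauchy_fun \<alpha> \<beta> 0 s" "cauchy_fun \<alpha> \<beta> s s = 0" for s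
    using assms by (simp_all add: u_fun_def cauchy_fun_def powr_add algebra_simps)
  have split: "u_fun \<alpha> \<beta> t s + cauchy_fun \<alpha> \<beta> t s = cauchy_fun \<alpha> \<beta> 0 s" for t s
    using assms
    by (simp add: u_fun_def cauchy_fun_def powr_add algebra_simps flip: add_divide_distrib)
  show "s \<le> \<tau> \<Longrightarrow> t \<le> s \<Longrightarrow> green_fun \<alpha> \<beta> \<tau> t s = u_fun \<alpha> \<beta> t s"
    by (simp add: green_fun_def)
  show "s \<le> \<tau> \<Longrightarrow> s \<le> t \<Longrightarrow> green_fun \<alpha> \<beta> \<tau> t s = cauchy_fun \<alpha> \<beta> 0 s"
    by (cases "t = s") (auto simp: green_fun_def diag)
  show "\<tau> \<le> s \<Longrightarrow> t \<le> s \<Longrightarrow> green_fun \<alpha> \<beta> \<tau> t s = u_fun \<alpha> \<beta> t \<tau>"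
    by (cases "s = \<tau>") (auto simp: green_fun_def)
  show "\<tau> \<le> s \<Longrightarrow> s \<le> t \<Longrightarrow> green_fun \<alpha> \<beta> \<tau> t s = u_fun \<alpha> \<beta> t \<tau> + cauchy_fun \<alpha> \<beta> t s"
    using split[of t \<tau>] by (cases "s = \<tau>"; cases "t = s") (auto simp: green_fun_def diag)
qed

definition solves_equation ::
  "real \<Rightarrow> real \<Rightarrow> real \<Rightarrow> (real \<Rightarrow> real) \<Rightarrow> (real \<Rightarrow> real) \<Rightarrow> bool" where
  "solves_equation \<alpha> \<beta> \<gamma> h y \<longleftrightarrow>
     (\<forall>t\<in>{0..1}.
        conf_differentiable \<alpha> y t \<and>
        conf_differentiable \<beta> (conf_deriv \<alpha> y) t \<and>
        conf_differentiable \<gamma> (conf_deriv \<beta> (conf_deriv \<alpha> y)) t \<and>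
        conf_deriv \<gamma> (conf_deriv \<beta> (conf_deriv \<alpha> y)) t = h t)"

definition boundary_conditions ::
  "real \<Rightarrow> real \<Rightarrow> real \<Rightarrow> (real \<Rightarrow> real) \<Rightarrow> bool" where
  "boundary_conditions \<alpha> \<beta> \<tau> y \<longleftrightarrow>
     y 0 = 0 \<and> conf_deriv \<alpha> y \<tau> = 0 \<and> conf_deriv \<beta> (conf_deriv \<alpha> y) 1 = 0"

text \<open>
  The clause on absolute integrability makes explicit that the integral defining \<open>y\<close> exists
  (as a Lebesgue integral); \<open>integral\<close> on its own would return \<open>0\<close> for a divergent integral.
\<close>

definition is_greens_function ::
  "real \<Rightarrow> real \<Rightarrow> real \<Rightarrow> real \<Rightarrow> (real \<Rightarrow> real \<Rightarrow> real) \<Rightarrow> bool" where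
  "is_greens_function \<alpha> \<beta> \<gamma> \<tau> G \<longleftrightarrow>
     (\<forall>h. continuous_on {0..1} h \<longrightarrow>
        (\<forall>t\<in>{0..1}. (\<lambda>s. G t s * h s * s powr (\<gamma> - 1)) absolutely_integrable_on {0..1}) \<and>
        (let y = (\<lambda>t. integral {0..1} (\<lambda>s. G t s * h s * s powr (\<gamma> - 1)))
         in solves_equation \<alpha> \<beta> \<gamma> h y \<and> boundary_conditions \<alpha> \<beta> \<tau> y))"

end

theory Submission
  imports Defs
begin

text \<open>
  The kernel has a closed form in which the case distinctions become truncations,
  \<open>G(t,s) = u(t, min s \<tau>) + x(t, min s t)\<close>, because \<open>x(t,t) = 0\<close> and \<open>u(t,s) + x(t,s) = x(0,s)\<close>.
  This form is visibly continuous in \<open>s\<close>, so the integrals converge absolutely, and both \<open>u\<close> and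
  \<open>x\<close> are sums of products of a power of \<open>t\<close> and a power of \<open>s\<close>.  Hence \<open>y\<close> is a combination of
  powers of \<open>t\<close> with the three moments
  \<open>H(t) = \<integral>\<^sub>0\<^sup>t h d\<mu>\<close>, \<open>M(t) = \<integral>\<^sub>0\<^sup>t s\<^sup>\<beta> h d\<mu>\<close>, \<open>N(t) = \<integral>\<^sub>0\<^sup>t s\<^sup>\<alpha>\<^sup>+\<^sup>\<beta> h d\<mu>\<close>, where \<open>d\<mu> = s\<^sup>\<gamma>\<^sup>-\<^sup>1 ds\<close>;
  no interchange of integrals is needed.

  In the derivative of this combination the terms that contain \<open>h(t)\<close> cancel, since \<open>x\<close> vanishes on
  the diagonal.  The same happens one level further down, and what remains is
  \<open>D\<^sup>\<alpha> y(t) = (M(\<tau>) - M(t) + \<tau>\<^sup>\<beta> (H(1) - H(\<tau>)) - t\<^sup>\<beta> (H(1) - H(t))) / \<beta>\<close> and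
  \<open>D\<^sup>\<beta> D\<^sup>\<alpha> y(t) = H(t) - H(1)\<close>.  The boundary conditions can be read off, and \<open>D\<^sup>\<gamma> H = h\<close> is the
  fundamental theorem of calculus.  All three derivatives extend continuously to \<open>t = 0\<close>, which is
  what the definition of the conformable derivative at \<open>0\<close> asks for
  (lemma \<open>conf_deriv_continuous_extension\<close>).
\<close>

section \<open>Conformable derivatives on the closed unit interval\<close>

text \<open>
  The derivative at \<open>0\<close> is a limit of derivatives at positive points, so an ordinary derivative
  on \<open>(0,1]\<close> of the form \<open>t\<^sup>\<alpha>\<^sup>-\<^sup>1 g(t)\<close> with \<open>g\<close> continuous up to \<open>0\<close> decides it.  The function \<open>F\<close>
  that is actually differentiated may differ from \<open>f\<close> off \<open>[0,1]\<close>: an iterated conformable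
  derivative is known only on \<open>[0,1]\<close>.
\<close>
lemma conf_deriv_continuous_extension:
  assumes eq: "\<And>t. t \<in> {0..1} \<Longrightarrow> f t = F t"
    and F: "\<And>t. t \<in> {0<..1} \<Longrightarrow>
      (F has_real_derivative t powr (\<alpha> - 1) * g t) (at t within {0..1})"
    and g: "continuous_on {0..1} g"
    and t: "t \<in> {0..1}"
  shows "conf_differentiable \<alpha> f t" and "conf_deriv \<alpha> f t = g t"
proof -
  have pos: "conf_differentiable \<alpha> f r \<and> conf_deriv \<alpha> f r = g r" if r: "r \<in> {0<..1}" for r
  proof -
    have "(f has_real_derivative r powr (\<alpha> - 1) * g r) (at r within {0..1})"
      using has_field_derivative_transform_within[OF F[OF r], of 1 f] r eq by auto
    moreover have "r powr (1 - \<alpha>) * (r powr (\<alpha> - 1) * g r) = g r"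
      using r by (simp add: mult.assoc[symmetric] powr_add[symmetric])
    ultimately show ?thesis
      using conf_deriv_eq r by fastforce
  qed
  have near: "\<forall>\<^sub>F r in at_right 0. r \<in> {0<..1::real}"
    using eventually_at_right_real[of 0 "1::real"] by (auto elim!: eventually_mono)
  have "(g \<longlongrightarrow> g 0) (at_right 0)"
    using g unfolding continuous_on_def
    by (metis at_within_Icc_at_right atLeastAtMost_iff order_refl zero_less_one less_imp_le)
  then have lim: "(conf_deriv \<alpha> f \<longlongrightarrow> g 0) (at_right 0)"
    by (rule Lim_transform_eventually) (use near pos in \<open>auto elim!: eventually_mono\<close>)
  then have "((\<lambda>r. Lim (conf_filter \<alpha> r) (conf_quotient \<alpha> f r)) \<longlongrightarrow> g 0) (at_right 0)"
    by (rule Lim_transform_eventually)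
       (rule eventually_mono[OF near], simp add: conf_deriv_def)
  then have zero: "conf_deriv \<alpha> f 0 = g 0"
    by (simp add: conf_deriv_def tendsto_Lim)
  have "\<forall>\<^sub>F r in at_right 0. \<exists>L. (conf_quotient \<alpha> f r \<longlongrightarrow> L) (conf_filter \<alpha> r)"
    using near
  proof (rule eventually_mono)
    fix r :: real assume "r \<in> {0<..1}"
    then show "\<exists>L. (conf_quotient \<alpha> f r \<longlongrightarrow> L) (conf_filter \<alpha> r)"
      using pos[of r] by (auto simp: conf_differentiable_def)
  qed
  then have "conf_differentiable \<alpha> f 0"
    using lim by (auto simp: conf_differentiable_def)
  then show "conf_differentiable \<alpha> f t" "conf_deriv \<alpha> f t = g t"
    using pos[of t] zero t by (cases "t = 0"; force)+
qed

section \<open>Conformable integrals\<close>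

definition conf_integral :: "real \<Rightarrow> (real \<Rightarrow> real) \<Rightarrow> real \<Rightarrow> real" where
  "conf_integral \<gamma> f t = integral {0..t} (\<lambda>s. f s * s powr (\<gamma> - 1))"

lemma conf_weight_absolutely_integrable:
  fixes f :: "real \<Rightarrow> real"
  assumes "0 < \<gamma>" and "continuous_on {0..1} f"
  shows "(\<lambda>s. f s * s powr (\<gamma> - 1)) absolutely_integrable_on {0..1}"
proof (rule absolutely_integrable_bounded_measurable_product_real)
  show "f \<in> borel_measurable (lebesgue_on {0..1})"
    using assms by (intro continuous_imp_measurable_on_sets_lebesgue) auto
  show "bounded (f ` {0..1})"
    using assms by (intro compact_imp_bounded compact_continuous_image) auto
  show "(\<lambda>s. s powr (\<gamma> - 1)) absolutely_integrable_on {0..1}"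
    using has_integral_powr_from_0[of "\<gamma> - 1" 1] assms(1)
    by (intro nonnegative_absolutely_integrable_1) auto
qed auto

lemma conf_weight_integrable:
  fixes f :: "real \<Rightarrow> real"
  assumes "0 < \<gamma>" and "continuous_on {0..1} f" and "{a..b} \<subseteq> {0..1}"
  shows "(\<lambda>s. f s * s powr (\<gamma> - 1)) integrable_on {a..b}"
  by (rule integrable_on_subinterval[OF set_lebesgue_integral_eq_integral(1)
        [OF conf_weight_absolutely_integrable[OF assms(1,2)]] assms(3)])

lemma conf_integral_0 [simp]: "conf_integral \<gamma> f 0 = 0"
  by (simp add: conf_integral_def)

lemma conf_integral_cmult: "conf_integral \<gamma> (\<lambda>s. c * f s) t = c * conf_integral \<gamma> f t"
  by (simp add: conf_integral_def mult.assoc)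

lemma conf_integral_add:
  assumes "0 < \<gamma>" "continuous_on {0..1} f" "continuous_on {0..1} g" "t \<in> {0..1}"
  shows "conf_integral \<gamma> (\<lambda>s. f s + g s) t = conf_integral \<gamma> f t + conf_integral \<gamma> g t"
  unfolding conf_integral_def distrib_right
  using assms by (intro integral_add conf_weight_integrable) auto

lemma continuous_on_conf_integral:
  assumes "0 < \<gamma>" "continuous_on {0..1} f"
  shows "continuous_on {0..1} (conf_integral \<gamma> f)"
  unfolding conf_integral_def [abs_def]
  by (rule indefinite_integral_continuous_1) (rule conf_weight_integrable[OF assms], simp)

lemma has_real_derivative_conf_integral:
  assumes "0 < \<gamma>" "continuous_on {0..1} f" "t \<in> {0<..1}"
  shows "(conf_integral \<gamma> f has_real_derivative t powr (\<gamma> - 1) * f t) (at t within {0..1})"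
proof -
  have "continuous (at t within {0..1}) (\<lambda>s. f s * s powr (\<gamma> - 1))"
    using assms(2,3)
    by (auto intro!: tendsto_intros simp: continuous_on_eq_continuous_within continuous_within)
  then have "(conf_integral \<gamma> f has_vector_derivative f t * t powr (\<gamma> - 1)) (at t within {0..1})"
    using integral_has_vector_derivative_continuous_at
            [OF conf_weight_integrable[OF assms(1,2) order_refl], of t "{}"] assms(3)
    by (simp add: conf_integral_def [abs_def])
  then show ?thesis
    by (simp add: has_real_derivative_iff_has_vector_derivative mult.commute)
qed

lemma continuous_on_truncated:
  fixes f :: "real \<Rightarrow> real"
  assumes "continuous_on {0..1} f" "c \<in> {0..1}"
  shows "continuous_on {0..1} (\<lambda>s. f (min s c))"
  using assms(2) by (intro continuous_on_compose2[OF assms(1)] continuous_intros) auto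

text \<open>
  Freezing one factor at \<open>c\<close> turns an integral over all of \<open>[0,1]\<close> into integrals of the original
  functions up to \<open>c\<close> and a boundary term.
\<close>
lemma conf_integral_truncated:
  assumes \<gamma>: "0 < \<gamma>" and \<phi>: "continuous_on {0..1} \<phi>" and h: "continuous_on {0..1} h"
    and c: "c \<in> {0..1}"
  shows "conf_integral \<gamma> (\<lambda>s. \<phi> (min s c) * h s) 1 =
    conf_integral \<gamma> (\<lambda>s. \<phi> s * h s) c + \<phi> c * (conf_integral \<gamma> h 1 - conf_integral \<gamma> h c)"
proof -
  let ?I = "\<lambda>f a b. integral {a..b} (\<lambda>s. f s * s powr (\<gamma> - 1))"
  have split: "?I f 0 1 = ?I f 0 c + ?I f c 1" if "continuous_on {0..1} f" for f
    using conf_weight_integrable[OF \<gamma> that order_refl] c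
    by (intro Henstock_Kurzweil_Integration.integral_combine[symmetric]) auto
  have "?I (\<lambda>s. \<phi> (min s c) * h s) 0 1 =
      ?I (\<lambda>s. \<phi> (min s c) * h s) 0 c + ?I (\<lambda>s. \<phi> (min s c) * h s) c 1"
    by (intro split continuous_on_mult continuous_on_truncated \<phi> h c)
  also have "?I (\<lambda>s. \<phi> (min s c) * h s) 0 c = ?I (\<lambda>s. \<phi> s * h s) 0 c"
    by (rule integral_cong) (simp add: min_def)
  also have "?I (\<lambda>s. \<phi> (min s c) * h s) c 1 = integral {c..1} (\<lambda>s. \<phi> c * (h s * s powr (\<gamma> - 1)))"
    by (rule integral_cong) (auto simp: min_def)
  also have "\<dots> = \<phi> c * ?I h c 1"
    by simp
  also have "?I h c 1 = ?I h 0 1 - ?I h 0 c"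
    using split[OF h] by simp
  finally show ?thesis
    by (simp add: conf_integral_def)
qed

section \<open>The kernel and its solution operator\<close>

lemma green_fun_truncated:
  assumes "0 < \<alpha>" "0 < \<beta>"
  shows "green_fun \<alpha> \<beta> \<tau> t s = u_fun \<alpha> \<beta> t (min s \<tau>) + cauchy_fun \<alpha> \<beta> t (min s t)"
proof -
  have "cauchy_fun \<alpha> \<beta> t t = 0"
    using assms by (simp add: cauchy_fun_def)
  moreover have "u_fun \<alpha> \<beta> t s + cauchy_fun \<alpha> \<beta> t s = cauchy_fun \<alpha> \<beta> 0 s"
    using assms
    by (simp add: u_fun_def cauchy_fun_def powr_add algebra_simps flip: add_divide_distrib)
  ultimately show ?thesis
    by (auto simp: green_fun_def min_def)
qed

lemma u_fun_separated:
  assumes "0 < \<alpha>" "0 < \<beta>"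
  shows "u_fun \<alpha> \<beta> t s = t powr \<alpha> / (\<alpha> * \<beta>) * s powr \<beta> + - (t powr (\<alpha> + \<beta>) / (\<beta> * (\<alpha> + \<beta>)))"
proof -
  have "\<alpha> + \<beta> \<noteq> 0" using assms by simp
  then show ?thesis
    using assms by (simp add: u_fun_def diff_divide_distrib)
qed

lemma cauchy_fun_separated:
  assumes "0 < \<alpha>" "0 < \<beta>"
  shows "cauchy_fun \<alpha> \<beta> t s = t powr (\<alpha> + \<beta>) / (\<beta> * (\<alpha> + \<beta>)) +
    - (t powr \<alpha> / (\<alpha> * \<beta>)) * s powr \<beta> + 1 / (\<alpha> * (\<alpha> + \<beta>)) * s powr (\<alpha> + \<beta>)"
proof -
  have "\<alpha> + \<beta> \<noteq> 0" using assms by simp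
  then show ?thesis
    using assms by (simp add: cauchy_fun_def powr_add divide_simps) (simp add: algebra_simps)
qed

lemma continuous_on_powr_pos:
  assumes "0 < p"
  shows "continuous_on {0..1} (\<lambda>s::real. s powr p)"
  using assms by (intro continuous_on_powr' continuous_intros) auto

lemma continuous_on_u_fun:
  assumes "0 < \<alpha>" "0 < \<beta>"
  shows "continuous_on {0..1} (u_fun \<alpha> \<beta> t)"
  unfolding u_fun_separated[OF assms, abs_def]
  using assms
  by (intro continuous_on_add continuous_on_mult continuous_on_const continuous_on_powr_pos)

lemma continuous_on_cauchy_fun:
  assumes "0 < \<alpha>" "0 < \<beta>"
  shows "continuous_on {0..1} (cauchy_fun \<alpha> \<beta> t)"
  unfolding cauchy_fun_separated[OF assms, abs_def]
  using assms
  by (intro continuous_on_add continuous_on_mult continuous_on_const continuous_on_powr_pos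
      add_pos_pos)

lemma continuous_on_green_fun:
  assumes "0 < \<alpha>" "0 < \<beta>" "\<tau> \<in> {0..1}" "t \<in> {0..1}"
  shows "continuous_on {0..1} (green_fun \<alpha> \<beta> \<tau> t)"
  unfolding green_fun_truncated[OF assms(1,2), abs_def]
  by (rule continuous_on_add; rule continuous_on_truncated)
     (fact continuous_on_u_fun[OF assms(1,2)] continuous_on_cauchy_fun[OF assms(1,2)] assms)+

text \<open>
  The three powers of \<open>t\<close> here carry the moments of \<open>h\<close> against \<open>1\<close>, \<open>s\<^sup>\<beta>\<close> and \<open>s\<^sup>\<alpha>\<^sup>+\<^sup>\<beta>\<close>.  The kernel
  \<open>x\<close> contributes no boundary term because it vanishes on the diagonal.
\<close>
lemma conf_integral_green_fun:
  fixes \<alpha> \<beta> \<gamma> \<tau> t :: real and h :: "real \<Rightarrow> real"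
  assumes pos: "0 < \<alpha>" "0 < \<beta>" "0 < \<gamma>" and h: "continuous_on {0..1} h"
    and \<tau>: "\<tau> \<in> {0..1}" and t: "t \<in> {0..1}"
  defines "H \<equiv> conf_integral \<gamma> h"
    and "M \<equiv> conf_integral \<gamma> (\<lambda>s. s powr \<beta> * h s)"
    and "N \<equiv> conf_integral \<gamma> (\<lambda>s. s powr (\<alpha> + \<beta>) * h s)"
  shows "conf_integral \<gamma> (\<lambda>s. green_fun \<alpha> \<beta> \<tau> t s * h s) 1 =
    t powr \<alpha> / (\<alpha> * \<beta>) * (M \<tau> + \<tau> powr \<beta> * (H 1 - H \<tau>) - M t)
    - t powr (\<alpha> + \<beta>) / (\<beta> * (\<alpha> + \<beta>)) * (H 1 - H t) + 1 / (\<alpha> * (\<alpha> + \<beta>)) * N t"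
proof -
  note u = continuous_on_u_fun[OF pos(1,2)] and x = continuous_on_cauchy_fun[OF pos(1,2)]
  note pow = continuous_on_powr_pos
  have "conf_integral \<gamma> (\<lambda>s. green_fun \<alpha> \<beta> \<tau> t s * h s) 1 =
      conf_integral \<gamma> (\<lambda>s. u_fun \<alpha> \<beta> t (min s \<tau>) * h s) 1 +
      conf_integral \<gamma> (\<lambda>s. cauchy_fun \<alpha> \<beta> t (min s t) * h s) 1"
    unfolding green_fun_truncated[OF pos(1,2)] distrib_right
    by (rule conf_integral_add[OF pos(3)];
        (rule continuous_on_mult[OF _ h], rule continuous_on_truncated)?)
       (fact u x \<tau> t | simp)+
  also have "conf_integral \<gamma> (\<lambda>s. u_fun \<alpha> \<beta> t (min s \<tau>) * h s) 1 =
      conf_integral \<gamma> (\<lambda>s. u_fun \<alpha> \<beta> t s * h s) \<tau> + u_fun \<alpha> \<beta> t \<tau> * (H 1 - H \<tau>)"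
    unfolding H_def using \<tau> pos by (intro conf_integral_truncated u x h)
  also have "conf_integral \<gamma> (\<lambda>s. cauchy_fun \<alpha> \<beta> t (min s t) * h s) 1 =
      conf_integral \<gamma> (\<lambda>s. cauchy_fun \<alpha> \<beta> t s * h s) t + cauchy_fun \<alpha> \<beta> t t * (H 1 - H t)"
    unfolding H_def using t pos by (intro conf_integral_truncated u x h)
  also have "cauchy_fun \<alpha> \<beta> t t = 0"
    by (simp add: cauchy_fun_def)
  also have "conf_integral \<gamma> (\<lambda>s. u_fun \<alpha> \<beta> t s * h s) \<tau> =
      t powr \<alpha> / (\<alpha> * \<beta>) * M \<tau> + - (t powr (\<alpha> + \<beta>) / (\<beta> * (\<alpha> + \<beta>))) * H \<tau>"
    unfolding u_fun_separated[OF pos(1,2)] distrib_right mult.assoc M_def H_def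
      conf_integral_cmult[symmetric]
    using pos \<tau>
    by (simp only: conf_integral_add continuous_on_mult continuous_on_const h pow)
  also have "conf_integral \<gamma> (\<lambda>s. cauchy_fun \<alpha> \<beta> t s * h s) t =
      t powr (\<alpha> + \<beta>) / (\<beta> * (\<alpha> + \<beta>)) * H t + - (t powr \<alpha> / (\<alpha> * \<beta>)) * M t
      + 1 / (\<alpha> * (\<alpha> + \<beta>)) * N t"
    unfolding cauchy_fun_separated[OF pos(1,2)] distrib_right mult.assoc M_def H_def N_def
      conf_integral_cmult[symmetric]
    using pos t
    by (simp only: conf_integral_add continuous_on_add continuous_on_mult continuous_on_const h pow
        add_pos_pos)
  finally show ?thesis
    unfolding u_fun_separated[OF pos(1,2)]
    by (simp add: algebra_simps diff_divide_distrib)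
qed

theorem theorem3p1:
  fixes \<alpha> \<beta> \<gamma> \<tau> :: real
  assumes "\<alpha> \<in> {0<..1}" and "\<beta> \<in> {0<..1}" and "\<gamma> \<in> {0<..1}"
    and "0 < \<tau>" and "\<tau> < 1"
  shows "is_greens_function \<alpha> \<beta> \<gamma> \<tau> (green_fun \<alpha> \<beta> \<tau>)"
proof -
  have pos: "0 < \<alpha>" "0 < \<beta>" "0 < \<gamma>" "0 < \<alpha> + \<beta>" and \<tau>: "\<tau> \<in> {0..1}"
    using assms by auto
  note pow = continuous_on_powr_pos
  show ?thesis
    unfolding is_greens_function_def Let_def
  proof (intro allI impI conjI ballI)
    fix h :: "real \<Rightarrow> real" and t :: real
    assume "continuous_on {0..1} h" "t \<in> {0..1}"
    then show "(\<lambda>s. green_fun \<alpha> \<beta> \<tau> t s * h s * s powr (\<gamma> - 1)) absolutely_integrable_on {0..1}"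
      using pos \<tau>
      by (intro conf_weight_absolutely_integrable continuous_intros continuous_on_green_fun)
  next
    fix h :: "real \<Rightarrow> real" assume h: "continuous_on {0..1} h"
    define y where "y = (\<lambda>t. integral {0..1} (\<lambda>s. green_fun \<alpha> \<beta> \<tau> t s * h s * s powr (\<gamma> - 1)))"
    \<comment> \<open>The functions \<open>Y\<close>, \<open>w\<close> and \<open>H - H 1\<close> are \<open>y\<close>, \<open>D\<^sup>\<alpha> y\<close> and \<open>D\<^sup>\<beta> D\<^sup>\<alpha> y\<close> on \<open>[0,1]\<close>.\<close>
    define H where "H = conf_integral \<gamma> h"
    define M where "M = conf_integral \<gamma> (\<lambda>s. s powr \<beta> * h s)"
    define N where "N = conf_integral \<gamma> (\<lambda>s. s powr (\<alpha> + \<beta>) * h s)"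
    define w where "w t = (M \<tau> - M t + \<tau> powr \<beta> * (H 1 - H \<tau>) - t powr \<beta> * (H 1 - H t)) / \<beta>" for t
    define Y where "Y t = t powr \<alpha> / (\<alpha> * \<beta>) * (M \<tau> + \<tau> powr \<beta> * (H 1 - H \<tau>) - M t)
        - t powr (\<alpha> + \<beta>) / (\<beta> * (\<alpha> + \<beta>)) * (H 1 - H t) + 1 / (\<alpha> * (\<alpha> + \<beta>)) * N t" for t
    have yY: "y t = Y t" if "t \<in> {0..1}" for t
      using conf_integral_green_fun[OF pos(1-3) h \<tau> that]
      by (simp add: y_def Y_def H_def M_def N_def conf_integral_def)
    have cont: "continuous_on {0..1} H" "continuous_on {0..1} M"
      unfolding H_def M_def using pos
      by (intro continuous_on_conf_integral continuous_on_mult pow h; simp)+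
    have dH: "(H has_real_derivative t powr (\<gamma> - 1) * h t) (at t within {0..1})"
      and dM: "(M has_real_derivative t powr (\<gamma> - 1) * (t powr \<beta> * h t)) (at t within {0..1})"
      and dN: "(N has_real_derivative t powr (\<gamma> - 1) * (t powr (\<alpha> + \<beta>) * h t)) (at t within {0..1})"
      if "t \<in> {0<..1}" for t
      unfolding H_def M_def N_def using pos that
      by (intro has_real_derivative_conf_integral continuous_on_mult pow h; simp)+
    have dpow: "((\<lambda>s. s powr p) has_real_derivative p * t powr (p - 1)) (at t within {0..1})"
      if "t \<in> {0<..1}" for p t :: real
      using that by (auto intro!: derivative_eq_intros)

    have dY: "(Y has_real_derivative t powr (\<alpha> - 1) * w t) (at t within {0..1})"
      if t: "t \<in> {0<..1}" for t
    proof -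
      define a where "a = 1 / (\<alpha> * \<beta>)"
      define b where "b = 1 / (\<beta> * (\<alpha> + \<beta>))"
      define c where "c = 1 / (\<alpha> * (\<alpha> + \<beta>))"
      define K where "K = M \<tau> + \<tau> powr \<beta> * (H 1 - H \<tau>)"
      define k where "k = t powr (\<gamma> - 1)"
      \<comment> \<open>The last identity is the one that removes \<open>h t\<close> from the derivative: it says \<open>x(t,t) = 0\<close>.\<close>
      have coeffs: "a * \<alpha> = 1 / \<beta>" "b * (\<alpha> + \<beta>) = 1 / \<beta>" "b + c - a = 0"
        using pos by (simp_all add: a_def b_def c_def divide_simps)
      have shift: "t powr (\<alpha> + \<beta> - 1) = t powr (\<alpha> - 1) * t powr \<beta>"
        by (simp add: powr_add[symmetric] algebra_simps)
      have split: "t powr (\<alpha> + \<beta>) = t powr \<alpha> * t powr \<beta>"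
        by (simp add: powr_add)
      have Y: "Y = (\<lambda>t. a * (t powr \<alpha> * (K - M t)) - b * (t powr (\<alpha> + \<beta>) * (H 1 - H t)) + c * N t)"
        by (simp add: Y_def a_def b_def c_def K_def fun_eq_iff)
      have "(Y has_real_derivative
          a * (\<alpha> * t powr (\<alpha> - 1) * (K - M t) + (0 - k * (t powr \<beta> * h t)) * t powr \<alpha>)
          - b * ((\<alpha> + \<beta>) * t powr (\<alpha> + \<beta> - 1) * (H 1 - H t) + (0 - k * h t) * t powr (\<alpha> + \<beta>))
          + c * (k * (t powr (\<alpha> + \<beta>) * h t))) (at t within {0..1})"
        unfolding Y k_def
        by (rule DERIV_add DERIV_diff DERIV_cmult DERIV_mult DERIV_const
              dH[OF t] dM[OF t] dN[OF t] dpow[OF t])+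
      also have "a * (\<alpha> * t powr (\<alpha> - 1) * (K - M t) + (0 - k * (t powr \<beta> * h t)) * t powr \<alpha>)
          - b * ((\<alpha> + \<beta>) * t powr (\<alpha> + \<beta> - 1) * (H 1 - H t) + (0 - k * h t) * t powr (\<alpha> + \<beta>))
          + c * (k * (t powr (\<alpha> + \<beta>) * h t))
        = t powr (\<alpha> - 1) * ((a * \<alpha>) * (K - M t) - (b * (\<alpha> + \<beta>)) * (t powr \<beta> * (H 1 - H t)))
          + (b + c - a) * (k * (t powr (\<alpha> + \<beta>) * h t))"
        unfolding shift split by (simp add: algebra_simps)
      also have "\<dots> = t powr (\<alpha> - 1) * w t"
        unfolding coeffs by (simp add: w_def K_def diff_divide_distrib add_divide_distrib)
      finally show ?thesis .
    qed
    have dw: "(w has_real_derivative t powr (\<beta> - 1) * (H t - H 1)) (at t within {0..1})"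
      if t: "t \<in> {0<..1}" for t
    proof -
      have "(w has_real_derivative
          (0 - t powr (\<gamma> - 1) * (t powr \<beta> * h t) + 0
           - (\<beta> * t powr (\<beta> - 1) * (H 1 - H t) + (0 - t powr (\<gamma> - 1) * h t) * t powr \<beta>)) / \<beta>)
          (at t within {0..1})"
        unfolding w_def [abs_def]
        by (rule DERIV_cdivide DERIV_add DERIV_diff DERIV_const DERIV_mult
              dH[OF t] dM[OF t] dpow[OF t])+
      then show ?thesis
        by (rule DERIV_cong) (use pos in \<open>simp add: divide_simps, simp add: algebra_simps\<close>)
    qed
    have dz: "((\<lambda>t. H t - H 1) has_real_derivative t powr (\<gamma> - 1) * h t) (at t within {0..1})"
      if "t \<in> {0<..1}" for t
      using dH[OF that] by (auto intro!: derivative_eq_intros)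

    have cw: "continuous_on {0..1} w" and cz: "continuous_on {0..1} (\<lambda>t. H t - H 1)"
      unfolding w_def [abs_def] using pos by (auto intro!: continuous_intros cont pow)
    have Dy: "conf_differentiable \<alpha> y t" "conf_deriv \<alpha> y t = w t" if "t \<in> {0..1}" for t
      by (rule conf_deriv_continuous_extension[OF yY dY cw that]; assumption)+
    have DDy: "conf_differentiable \<beta> (conf_deriv \<alpha> y) t"
      "conf_deriv \<beta> (conf_deriv \<alpha> y) t = H t - H 1" if "t \<in> {0..1}" for t
      by (rule conf_deriv_continuous_extension[OF Dy(2) dw cz that]; assumption)+
    have DDDy: "conf_differentiable \<gamma> (conf_deriv \<beta> (conf_deriv \<alpha> y)) t"
      "conf_deriv \<gamma> (conf_deriv \<beta> (conf_deriv \<alpha> y)) t = h t" if "t \<in> {0..1}" for t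
      by (rule conf_deriv_continuous_extension[OF DDy(2) dz h that]; assumption)+
    show "solves_equation \<alpha> \<beta> \<gamma> h y"
      unfolding solves_equation_def by (intro ballI conjI Dy(1) DDy(1) DDDy)
    have "y 0 = 0"
      using yY[of 0] by (simp add: Y_def N_def)
    moreover have "conf_deriv \<alpha> y \<tau> = 0"
      using Dy(2)[OF \<tau>] by (simp add: w_def)
    moreover have "conf_deriv \<beta> (conf_deriv \<alpha> y) 1 = 0"
      using DDy(2)[of 1] by simp
    ultimately show "boundary_conditions \<alpha> \<beta> \<tau> y"
      by (simp add: boundary_conditions_def)
  qed
qed

end
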